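(* For all $n\ge k\ge3$, \[ g^{\mathrm p}_n(1k)=\sum_{i=1}^{k-1}\beta_{k,i}\,b^{\mathrm p}_i\,g^{\mathrm p}_{n-i}, \] where $\beta_{k,i}=\binom{k-2}{i-1}+\binom{k-3}{i-2}$ and $b^{\mathrm p}_i=(-1)^{i+1}\theta^{\lfloor i/2\rfloor}$. Moreover, $G^{\mathrm p}(x)=\bigl(1-B^{\mathrm p}(x)\bigr)^{-2}$, where \[ B^{\mathrm p}(x)=\sum_{n\ge1}b^{\mathrm p}_n\frac{x^n}{n!}=1+\frac{\sinh(\sqrt\theta\,x)}{\sqrt\theta}-\cosh(\sqrt\theta\,x). \]
   Context: $\mathcal S_n$ is the set of permutations of $[n]$. For $\pi\in\mathcal S_n$ written in standard cycle form (each cycle begins with its smallest element, cycles ordered left to right by increasing smallest elements), $\mathrm{Flatten}(\pi)$ is the word obtained by erasing the parentheses. For a word $w$, $\mathrm p(w)$ is the number of peaks, i.e. indices $i$ with $w_{i+1}=\max\{w_i,w_{i+1},w_{i+2}\}$. For letters $a_1,\dots,a_k$, $g^{\mathrm p}_n(a_1\cdots a_k)=\sum_\pi q^{\mathrm p(\mathrm{Flatten}(\pi))}$ over $\pi\in\mathcal S_n$ with $\mathrm{Flatten}(\pi)$ beginning with $a_1\cdots a_k$, and $g^{\mathrm p}_n=g^{\mathrm p}_n(1)$. $G^{\mathrm p}(x)=\sum_{n\ge0}g^{\mathrm p}_{n+1}\frac{x^n}{n!}$. Here $q$ is an indeterminate and $\theta=1-q$; binomial coefficients with negative lower index are $0$.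 *)

theory Defs
  imports
    "HOL-Library.Sublist"
    "HOL-Combinatorics.Cycles"
    "HOL-Computational_Algebra.Computational_Algebra"
    "HOL-Algebra.Algebraic_Closure_Type"
begin

text \<open>
  The library term \<open>Cycles.support \<pi> a\<close> is the list \<open>[a, \<pi> a, \<pi> (\<pi> a), \<dots>]\<close>, running once
  through the cycle of \<open>a\<close> (and \<open>[a]\<close> for a fixed point). Keeping only the \<open>a\<close> that are minimal in
  their cycle, in increasing order, gives the standard cycle form, fixed points included.
\<close>

definition std_cycle_form :: "nat \<Rightarrow> (nat \<Rightarrow> nat) \<Rightarrow> nat list list" where
  "std_cycle_form n \<pi> =
     map (Cycles.support \<pi>) (filter (\<lambda>a. a = Min (set (Cycles.support \<pi> a))) [1..<n+1])"

definition Flatten :: "nat \<Rightarrow> (nat \<Rightarrow> nat) \<Rightarrow> nat list" where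
  "Flatten n \<pi> = concat (std_cycle_form n \<pi>)"

definition peaks :: "nat list \<Rightarrow> nat" where
  "peaks w = card {i. i + 2 < length w \<and> w ! (i+1) = Max {w ! i, w ! (i+1), w ! (i+2)}}"

text \<open>The indeterminate \<open>q\<close> is the generator of \<open>\<rat>[q]\<close>.\<close>

definition q :: "rat poly" where
  "q = [:0, 1:]"

definition \<theta> :: "rat poly" where
  "\<theta> = 1 - q"

definition gp :: "nat \<Rightarrow> nat list \<Rightarrow> rat poly" where
  "gp n w = (\<Sum>\<pi> | \<pi> permutes {1..n} \<and> prefix w (Flatten n \<pi>). q ^ peaks (Flatten n \<pi>))"

definition bp :: "nat \<Rightarrow> rat poly" where
  "bp i = (-1) ^ (i+1) * \<theta> ^ (i div 2)"

definition binom :: "nat \<Rightarrow> int \<Rightarrow> nat" where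
  "binom m j = (if j < 0 then 0 else m choose nat j)"

definition \<beta> :: "nat \<Rightarrow> nat \<Rightarrow> nat" where
  "\<beta> k i = binom (k-2) (int i - 1) + binom (k-3) (int i - 2)"

text \<open>
  The generating functions are formal power series in \<open>x\<close> over the field \<open>\<rat>(q)\<close>.
\<close>

definition Gp :: "rat poly fract fps" where
  "Gp = Abs_fps (\<lambda>n. to_fract (gp (n+1) [1]) / fact n)"

definition Bp :: "rat poly fract fps" where
  "Bp = Abs_fps (\<lambda>n. if n \<ge> 1 then to_fract (bp n) / fact n else 0)"

text \<open>
  The element \<open>\<theta>\<close> has no square root in \<open>\<rat>(q)\<close>, so the closed form of \<open>Bp\<close> is an identity of power
  series over the algebraic closure of \<open>\<rat>(q)\<close>, into which \<open>Bp\<close> is mapped coefficientwise.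
\<close>

definition fps_to_ac :: "'a::field fps \<Rightarrow> 'a alg_closure fps" where
  "fps_to_ac F = Abs_fps (\<lambda>n. to_ac (fps_nth F n))"

text \<open>The series \<open>sinh (c x)\<close> and \<open>cosh (c x)\<close>.\<close>

definition fps_sinh :: "'a::field_char_0 \<Rightarrow> 'a fps" where
  "fps_sinh c = (fps_exp c - fps_exp (-c)) / fps_const 2"

definition fps_cosh :: "'a::field_char_0 \<Rightarrow> 'a fps" where
  "fps_cosh c = (fps_exp c + fps_exp (-c)) / fps_const 2"

end

theory Submission
  imports Defs
begin

text \<open>
  Removing the point \<open>a\<close> from a permutation, that is writing it as \<open>transpose a b \<circ> p\<close> with \<open>p\<close>
  fixing \<open>a\<close>, deletes the first letter of the flattened word read from \<open>a\<close>; the next letter is \<open>b\<close>,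
  or the least remaining letter if \<open>b = a\<close>. Hence the words can be summed letter by letter, and
  since only relative order matters, the sums satisfy a recursion in the rank of the last letter
  and the number of unread letters. Comparing neighbouring ranks \<open>r\<close> and \<open>r + 1\<close> in this recursion
  leaves a multiple of \<open>\<theta>\<close> times a tail of the sum for words shorter by two, which yields
  \<open>g\<^sub>n(1k)\<close> by induction on \<open>k\<close>. Summing over \<open>k\<close> turns this into a linear recurrence for \<open>g\<^sub>n\<close>,
  equivalent to \<open>G' = (B G)' + B' G\<close>, so that \<open>G (1 - B)\<^sup>2\<close> has derivative zero.
\<close>

section \<open>Cycles and the removal of a point\<close>

lemma self_in_support:
  assumes "permutation p"
  shows "a \<in> set (Cycles.support p a)"
  using least_power_of_permutation(2)[OF assms, of a] by force

lemma set_support_eqI: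
  assumes "permutation p" and "c \<in> set (Cycles.support p a)"
  shows "set (Cycles.support p c) = set (Cycles.support p a)"
proof -
  have "\<not> set (Cycles.support p c) \<inter> set (Cycles.support p a) = {}"
    unfolding disjoint_support'[OF assms(1)] using assms(2) by simp
  then show ?thesis
    by (rule contrapos_np) (rule disjointD[OF disjoint_support[OF assms(1)] rangeI rangeI])
qed

text \<open>As \<open>p\<close> fixes \<open>a\<close>, the first step of
  \<open>transpose a b \<circ> p\<close> leads from \<open>a\<close> to \<open>b\<close>. From there
  it follows \<open>p\<close> until \<open>p\<close> would return to \<open>b\<close>; at that
  moment the transposition diverts to \<open>a\<close>. So \<open>a\<close> is inserted directly
  before \<open>b\<close>.\<close>

lemma support_transpose_start:
  assumes p: "p permutes S" and S: "finite S" and a: "a \<notin> S" and b: "b \<in> S"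
  shows "Cycles.support (transpose a b \<circ> p) a = a # Cycles.support p b"
proof -
  let ?r = "transpose a b \<circ> p" and ?l = "least_power p b"
  have perm: "permutation p" using p S permutation_permutes by blast
  have pw: "(p ^^ i) b \<in> S" for i
    using permutes_in_image[OF permutes_funpow[OF p]] b by blast
  have step: "(?r ^^ Suc i) a = (p ^^ i) b" if "i < ?l" for i
    using that
  proof (induction i)
    case 0
    have "p a = a" using p a by (simp add: permutes_not_in)
    then show ?case by simp
  next
    case (Suc i)
    have "(p ^^ Suc i) b \<noteq> b"
      using least_power_le[of "Suc i" p b] Suc.prems by auto
    moreover have "(p ^^ Suc i) b \<noteq> a" using pw[of "Suc i"] a by metis
    ultimately have "transpose a b ((p ^^ Suc i) b) = (p ^^ Suc i) b" by simp
    moreover have "(?r ^^ Suc (Suc i)) a = ?r ((p ^^ i) b)"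
      using Suc.IH Suc.prems by (metis Suc_lessD funpow.simps(2) o_apply)
    ultimately show ?case by (metis funpow.simps(2) o_apply)
  qed
  have l: "?l > 0" "(p ^^ ?l) b = b"
    using least_power_of_permutation[OF perm] by auto
  have last: "(?r ^^ Suc ?l) a = a"
  proof -
    obtain j where j: "?l = Suc j" using l(1) gr0_implies_Suc by blast
    have "(?r ^^ Suc ?l) a = ?r ((?r ^^ Suc j) a)" by (simp only: j funpow.simps o_apply)
    also have "\<dots> = transpose a b (p ((p ^^ j) b))" using step[of j] j by simp
    also have "p ((p ^^ j) b) = b" using l(2) j by simp
    also have "transpose a b b = a" by simp
    finally show ?thesis .
  qed
  have "least_power ?r a = Suc ?l"
    unfolding least_power_def[of ?r]
  proof (rule Least_equality)
    show "(?r ^^ Suc ?l) a = a \<and> Suc ?l > 0" using last by blast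
    fix m assume m: "(?r ^^ m) a = a \<and> m > 0"
    show "Suc ?l \<le> m"
    proof (rule ccontr)
      assume "\<not> Suc ?l \<le> m"
      then obtain j where "m = Suc j" "j < ?l" using m by (cases m) auto
      then have "(p ^^ j) b = a" using m step by metis
      then show False using pw a by metis
    qed
  qed
  then have "length (Cycles.support ?r a) = Suc ?l" by simp
  moreover have "Cycles.support ?r a ! i = (a # Cycles.support p b) ! i" if "i < Suc ?l" for i
  proof (cases i)
    case 0
    then show ?thesis using \<open>least_power ?r a = Suc ?l\<close> by (simp del: upt_Suc)
  next
    case (Suc j)
    then have "j < ?l" using that by simp
    then show ?thesis
      using Suc step[of j] \<open>least_power ?r a = Suc ?l\<close> by (simp del: upt_Suc funpow.simps)
  qed
  ultimately show ?thesis by (intro nth_equalityI) (simp_all del: upt_Suc)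
qed

text \<open>A cycle inside \<open>S\<close> that does not contain \<open>b\<close> meets neither of
  the two swapped points.\<close>

lemma support_transpose_other:
  assumes p: "p permutes S" and S: "finite S" and a: "a \<notin> S"
    and c: "c \<in> S - set (Cycles.support p b)"
  shows "Cycles.support (transpose a b \<circ> p) c = Cycles.support p c"
proof -
  have perm: "permutation p" using p S permutation_permutes by blast
  have avoids_b: "(p ^^ i) c \<noteq> b" for i
  proof
    assume "(p ^^ i) c = b"
    then have "b \<in> set (Cycles.support p c)"
      unfolding support_set[OF perm] by blast
    then have "set (Cycles.support p b) = set (Cycles.support p c)"
      by (rule set_support_eqI[OF perm])
    then show False using c self_in_support[OF perm] by blast
  qed
  have avoids_a: "(p ^^ i) c \<noteq> a" for i
    using permutes_in_image[OF permutes_funpow[OF p]] c a by (metis DiffD1)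
  have "((transpose a b \<circ> p) ^^ i) c = (p ^^ i) c" for i
  proof (induction i)
    case (Suc i)
    then show ?case using avoids_a[of "Suc i"] avoids_b[of "Suc i"] by simp
  qed simp
  then show ?thesis by (simp add: least_power_def)
qed

section \<open>Flattened words read from an arbitrary starting letter\<close>

definition flatten_on :: "(nat \<Rightarrow> nat) \<Rightarrow> nat set \<Rightarrow> nat list" where
  "flatten_on p A =
     concat (map (Cycles.support p) (sorted_list_of_set {c \<in> A. c = Min (set (Cycles.support p c))}))"

text \<open>
  Unlike in the standard cycle form, the first cycle may start at a non-minimal \<open>a\<close>: deleting the
  first letter of a word leaves a word of this kind.
\<close>

definition flatten_from :: "nat \<Rightarrow> nat set \<Rightarrow> (nat \<Rightarrow> nat) \<Rightarrow> nat list" where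
  "flatten_from a S p = Cycles.support p a @ flatten_on p (S - set (Cycles.support p a))"

lemma flatten_on_cong:
  assumes "\<And>c. c \<in> A \<Longrightarrow> Cycles.support p c = Cycles.support r c"
  shows "flatten_on p A = flatten_on r A"
proof -
  let ?M = "\<lambda>p. {c \<in> A. c = Min (set (Cycles.support p c))}"
  have M: "?M p = ?M r"
  proof (intro Collect_cong conj_cong refl)
    fix c assume "c \<in> A"
    then have "Cycles.support p c = Cycles.support r c" by (rule assms)
    then show "c = Min (set (Cycles.support p c)) \<longleftrightarrow> c = Min (set (Cycles.support r c))"
      by (rule arg_cong)
  qed
  have "c \<in> A" if "c \<in> set (sorted_list_of_set (?M r))" for c
    using that by (cases "finite (?M r)") simp_all
  then have "map (Cycles.support p) (sorted_list_of_set (?M r))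
    = map (Cycles.support r) (sorted_list_of_set (?M r))"
    by (intro map_cong refl assms)
  then show ?thesis
    unfolding flatten_on_def M by (rule arg_cong)
qed

text \<open>\<open>Min S\<close> is least in its own cycle and hence the first cycle leader; no
  other element of that cycle is a leader, so removing the cycle removes exactly one leader. This
  identifies the word that follows a closed cycle.\<close>

lemma flatten_on_eq_flatten_from_Min:
  assumes p: "p permutes S" and S: "finite S" "S \<noteq> {}"
  shows "flatten_on p S = flatten_from (Min S) S p"
proof -
  let ?M = "\<lambda>A. {c \<in> A. c = Min (set (Cycles.support p c))}"
  have perm: "permutation p" using p S permutation_permutes by blast
  note self = self_in_support[OF perm]
  have sub: "set (Cycles.support p c) \<subseteq> S" if "c \<in> S" for c
    unfolding support_set[OF perm] using permutes_in_image[OF permutes_funpow[OF p]] that by blast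
  have mS: "Min S \<in> S" using S by simp
  have "Min S = Min (set (Cycles.support p (Min S)))"
    using sub[OF mS] self[of "Min S"] S
    by (metis List.finite_set Min_eqI Min_le subsetD)
  then have mM: "Min S \<in> ?M S" using mS by simp
  then have MinM: "Min (?M S) = Min S"
    by (intro Min_eqI) (use S in auto)
  have "?M S - {Min S} = ?M (S - set (Cycles.support p (Min S)))"
  proof -
    have "c = Min S" if "c \<in> set (Cycles.support p (Min S))" "c \<in> ?M S" for c
    proof -
      have "set (Cycles.support p c) = set (Cycles.support p (Min S))"
        using set_support_eqI[OF perm that(1)] .
      then show ?thesis using that(2) mM by simp
    qed
    then show ?thesis using self[of "Min S"] by blast
  qed
  moreover have "sorted_list_of_set (?M S) = Min S # sorted_list_of_set (?M S - {Min S})"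
    using sorted_list_of_set_nonempty[of "?M S"] mM S MinM by fastforce
  ultimately show ?thesis by (simp add: flatten_on_def flatten_from_def)
qed

lemma flatten_from_transpose:
  assumes p: "p permutes S" and S: "finite S" and a: "a \<notin> S" and b: "b \<in> S"
  shows "flatten_from a (insert a S) (transpose a b \<circ> p) = a # flatten_from b S p"
proof -
  have "flatten_on (transpose a b \<circ> p) (S - set (Cycles.support p b)) = flatten_on p (S - set (Cycles.support p b))"
    by (intro flatten_on_cong support_transpose_other[OF p S a])
  moreover have "insert a S - set (a # Cycles.support p b) = S - set (Cycles.support p b)"
    using a by auto
  ultimately show ?thesis unfolding flatten_from_def support_transpose_start[OF assms] by simp
qed

lemma flatten_from_fixpoint:
  assumes p: "p permutes S" and S: "finite S" "S \<noteq> {}" and a: "a \<notin> S"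
  shows "flatten_from a (insert a S) p = a # flatten_from (Min S) S p"
proof -
  have "p a = a" using p a by (simp add: permutes_not_in)
  then have "least_power p a = 1" unfolding least_power_def by (intro Least_equality) auto
  then have "Cycles.support p a = [a]" by simp
  then show ?thesis
    using flatten_on_eq_flatten_from_Min[OF p S] a unfolding flatten_from_def by simp
qed

lemma flatten_from_singleton: "flatten_from a {a} id = [a]"
proof -
  have "least_power id a = 1" unfolding least_power_def by (intro Least_equality) auto
  then show ?thesis by (simp add: flatten_from_def flatten_on_def)
qed

text \<open>Each permutation of \<open>insert a S\<close> is \<open>transpose a b \<circ> p\<close>
  for exactly one \<open>b\<close> and one \<open>p\<close> permuting \<open>S\<close>. The choice
  \<open>b = a\<close> leaves \<open>a\<close> fixed, and the next cycle opens at
  \<open>Min S\<close>; it yields the same word as \<open>b = Min S\<close>, hence the weight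
  2.\<close>

lemma sum_flatten_from:
  assumes S: "finite S" "S \<noteq> {}" and a: "a \<notin> S"
  shows "(\<Sum>p | p permutes insert a S. F (flatten_from a (insert a S) p))
    = (\<Sum>b\<in>S. (if b = Min S then 2 else 1) * (\<Sum>p | p permutes S. F (a # flatten_from b S p) :: 'a :: comm_semiring_1))"
proof -
  let ?T = "\<lambda>b. \<Sum>p | p permutes S. F (a # flatten_from b S p)"
  have "(\<Sum>p | p permutes insert a S. F (flatten_from a (insert a S) p))
    = (\<Sum>b\<in>insert a S. \<Sum>p | p permutes S. F (flatten_from a (insert a S) (transpose a b \<circ> p)))"
    by (rule sum_over_permutations_insert[OF S(1) a])
  also have "\<dots> = (\<Sum>p | p permutes S. F (flatten_from a (insert a S) (transpose a a \<circ> p)))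
     + (\<Sum>b\<in>S. \<Sum>p | p permutes S. F (flatten_from a (insert a S) (transpose a b \<circ> p)))"
    using S a by simp
  also have "\<dots> = ?T (Min S) + (\<Sum>b\<in>S. ?T b)"
    using flatten_from_fixpoint[OF _ S a] flatten_from_transpose[OF _ S(1) a] by simp
  also have "\<dots> = (\<Sum>b\<in>S. (if b = Min S then ?T b else 0) + ?T b)"
    using S by (simp add: sum.distrib)
  also have "\<dots> = (\<Sum>b\<in>S. (if b = Min S then 2 else 1) * ?T b)"
    by (intro sum.cong) (auto simp: algebra_simps mult_2)
  finally show ?thesis .
qed

lemma Flatten_eq_flatten_on: "Flatten n p = flatten_on p {1..n}"
proof -
  have "sorted_list_of_set {c \<in> {1..n}. P c} = filter P [1..<n+1]" for P
    by (rule sorted_distinct_set_unique) (auto simp: sorted_wrt_filter simp del: upt_Suc)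
  then show ?thesis
    unfolding Flatten_def std_cycle_form_def flatten_on_def by (simp only:)
qed

lemma flatten_from_eq_Cons:
  assumes "p permutes S" and "finite S"
  obtains w where "flatten_from b S p = b # w"
proof -
  have "permutation p" using assms permutation_permutes by blast
  then have "least_power p b > 0" by (rule least_power_of_permutation)
  then have "Cycles.support p b = b # map (\<lambda>i. (p ^^ i) b) [1..<least_power p b]"
    by (simp add: upt_conv_Cons)
  then show thesis using that unfolding flatten_from_def by simp
qed

lemma Flatten_eq_flatten_from:
  assumes "p permutes {1..n}" and "n \<ge> 1"
  shows "Flatten n p = flatten_from 1 (insert 1 {2..n}) p"
proof -
  have S: "{1..n} = insert 1 {2..n}" using assms(2) by auto
  have "Min {1..n} = 1" using assms(2) by (intro Min_eqI) auto
  then show ?thesis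
    using flatten_on_eq_flatten_from_Min[OF assms(1)] assms(2)
    unfolding Flatten_eq_flatten_on S by simp
qed

section \<open>Peaks and the recursion by rank\<close>

lemma peaks_short: "length w \<le> 2 \<Longrightarrow> peaks w = 0"
  by (simp add: peaks_def)

lemma peaks_Cons:
  "peaks (x # y # z # w) = of_bool (x \<le> y \<and> z \<le> y) + peaks (y # z # w)"
proof -
  let ?P = "\<lambda>w i. i + 2 < length w \<and> w ! (i+1) = Max {w ! i, w ! (i+1), w ! (i+2)}"
  let ?v = "y # z # w"
  have "?P (x # ?v) 0 \<longleftrightarrow> x \<le> y \<and> z \<le> y"
    by (auto simp: max_def)
  moreover have "?P (x # ?v) (Suc i) \<longleftrightarrow> ?P ?v i" for i
    by simp
  ultimately have "?P (x # ?v) i \<longleftrightarrow>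
      i \<in> {i. i = 0 \<and> x \<le> y \<and> z \<le> y} \<union> Suc ` {i. ?P ?v i}" for i
    by (cases i) (simp_all only: Un_iff image_iff mem_Collect_eq, auto)
  then have "{i. ?P (x # ?v) i} = {i. i = 0 \<and> x \<le> y \<and> z \<le> y} \<union> Suc ` {i. ?P ?v i}"
    by blast
  then have "peaks (x # ?v) = card ({i. i = 0 \<and> x \<le> y \<and> z \<le> y} \<union> Suc ` {i. ?P ?v i})"
    unfolding peaks_def by (rule arg_cong)
  also have "\<dots> = card {i::nat. i = 0 \<and> x \<le> y \<and> z \<le> y} + card (Suc ` {i. ?P ?v i})"
  proof (rule card_Un_disjoint)
    show "finite (Suc ` {i. ?P ?v i})"
      by (rule finite_imageI, rule finite_subset[of _ "{..<length ?v}"]) auto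
  qed auto
  also have "card (Suc ` {i. ?P ?v i}) = peaks ?v"
    unfolding peaks_def by (simp only: card_image[OF inj_Suc[THEN inj_on_subset, OF subset_UNIV]])
  also have "card {i::nat. i = 0 \<and> x \<le> y \<and> z \<le> y} = of_bool (x \<le> y \<and> z \<le> y)"
    by simp
  finally show ?thesis .
qed

text \<open>The rank map is strictly increasing on \<open>S\<close>, hence a bijection onto an
  initial segment. A sum that sees letters only through their ranks thus depends on \<open>S\<close>
  only through its size.\<close>

lemma sum_over_ranks:
  fixes S :: "nat set"
  assumes "finite S"
  shows "(\<Sum>b\<in>S. f (card {c \<in> S. c < b})) = (\<Sum>s<card S. f s)"
proof -
  let ?r = "\<lambda>b. card {c \<in> S. c < b}"
  have less: "?r b < ?r c" if "b \<in> S" "b < c" for b c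
    using that assms by (intro psubset_card_mono) auto
  then have inj: "inj_on ?r S"
    by (intro linorder_inj_onI) force+
  moreover have "?r ` S \<subseteq> {..<card S}"
    using assms by (auto intro!: psubset_card_mono)
  ultimately have "bij_betw ?r S {..<card S}"
    using card_subset_eq[of "{..<card S}" "?r ` S"] by (simp add: bij_betw_def card_image)
  then show ?thesis by (rule sum.reindex_bij_betw)
qed

text \<open>
  The sum of \<open>q\<close> to the number of peaks over all flattened words whose last letter read so far
  was reached by an ascent (\<open>asc\<close>) or a descent and exceeds exactly \<open>r\<close> of the \<open>m\<close> letters not
  yet read. The least unread letter counts twice because it either continues the current cycle
  or opens a new one.
\<close>

primrec peak_poly :: "bool \<Rightarrow> nat \<Rightarrow> nat \<Rightarrow> rat poly" where
  "peak_poly asc r 0 = 1"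
| "peak_poly asc r (Suc m) =
     (\<Sum>s<Suc m. (if s = 0 then 2 else 1) * (if asc \<and> s < r then q else 1) * peak_poly (r \<le> s) s m)"

text \<open>Induction on the number of unread letters. The letter \<open>x\<close> stands for the
  one read before \<open>a\<close>, so that a peak at \<open>a\<close> can be recognised once the
  next letter \<open>b\<close> is known; then \<open>a\<close> takes over the role of
  \<open>x\<close>.\<close>

lemma sum_peaks_flatten_from:
  assumes "finite S" and "a \<notin> S" and "x \<noteq> a" and "x \<notin> S"
  shows "(\<Sum>p | p permutes insert a S. q ^ peaks (x # flatten_from a (insert a S) p))
    = peak_poly (x < a) (card {c \<in> S. c < a}) (card S)"
  using assms
proof (induction "card S" arbitrary: S a x)
  case 0
  then have "S = {}" by simp
  then show ?case using flatten_from_singleton[of a, unfolded id_def] by (simp add: peaks_short id_def)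
next
  case (Suc m)
  have S: "finite S" "S \<noteq> {}" using Suc by auto
  let ?r = "\<lambda>b. card {c \<in> S. c < b}"
  have tail: "(\<Sum>p | p permutes S. q ^ peaks (x # a # flatten_from b S p))
      = (if x < a \<and> ?r b < ?r a then q else 1) * peak_poly (?r a \<le> ?r b) (?r b) m"
    if b: "b \<in> S" for b
  proof -
    have ab: "a \<noteq> b" using b Suc.prems by auto
    have ranks: "?r b < ?r a \<longleftrightarrow> b < a"
    proof (cases "b < a")
      case True
      then have "?r b < ?r a" using b S by (intro psubset_card_mono) auto
      then show ?thesis using True by simp
    next
      case False
      then have "?r a \<le> ?r b" using S by (intro card_mono) auto
      then show ?thesis using False by simp
    qed
    have "q ^ peaks (x # a # flatten_from b S p)
        = (if x < a \<and> b < a then q else 1) * q ^ peaks (a # flatten_from b S p)"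
      if p: "p permutes S" for p
    proof -
      obtain w where "flatten_from b S p = b # w"
        using flatten_from_eq_Cons[OF p S(1)] by blast
      \<comment> \<open>Neighbouring letters are distinct, so the weak inequalities in
        \<open>peaks_Cons\<close> become strict.\<close>
      then show ?thesis using Suc.prems ab by (auto simp: peaks_Cons le_less)
    qed
    then have "(\<Sum>p | p permutes S. q ^ peaks (x # a # flatten_from b S p))
        = (if x < a \<and> b < a then q else 1) * (\<Sum>p | p permutes S. q ^ peaks (a # flatten_from b S p))"
      by (simp add: sum_distrib_left)
    \<comment> \<open>Induction hypothesis with \<open>b\<close> as current and \<open>a\<close> as
      previous letter. The unread letters are \<open>S - {b}\<close>, where \<open>b\<close> has the
      same rank as in \<open>S\<close>.\<close>
    also have "(\<Sum>p | p permutes S. q ^ peaks (a # flatten_from b S p))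
        = peak_poly (a < b) (card {c \<in> S - {b}. c < b}) m"
      using Suc.hyps(1)[of "S - {b}" b a] Suc.hyps(2)[symmetric] Suc.prems b ab S
      by (simp add: insert_absorb)
    also have "{c \<in> S - {b}. c < b} = {c \<in> S. c < b}" by auto
    also have "a < b \<longleftrightarrow> ?r a \<le> ?r b" using ranks ab by linarith
    finally show ?thesis using ranks by simp
  qed
  have min: "b = Min S \<longleftrightarrow> ?r b = 0" if "b \<in> S" for b
  proof -
    have "?r b = 0 \<longleftrightarrow> (\<forall>c\<in>S. b \<le> c)" using S by (auto simp: not_less)
    also have "\<dots> \<longleftrightarrow> b = Min S" using S that by (metis Min_eqI Min_le)
    finally show ?thesis by (rule sym)
  qed
  have "(\<Sum>p | p permutes insert a S. q ^ peaks (x # flatten_from a (insert a S) p))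
      = (\<Sum>b\<in>S. (if b = Min S then 2 else 1) * (\<Sum>p | p permutes S. q ^ peaks (x # a # flatten_from b S p)))"
    using sum_flatten_from[OF S Suc.prems(2), of "\<lambda>w. q ^ peaks (x # w)"] .
  also have "\<dots> = (\<Sum>b\<in>S. (if ?r b = 0 then 2 else 1) *
      ((if x < a \<and> ?r b < ?r a then q else 1) * peak_poly (?r a \<le> ?r b) (?r b) m))"
    by (intro sum.cong refl) (simp only: min tail)
  also have "\<dots> = (\<Sum>s<card S. (if s = 0 then 2 else 1) *
      ((if x < a \<and> s < ?r a then q else 1) * peak_poly (?r a \<le> s) s m))"
    by (rule sum_over_ranks[OF S(1)])
  finally show ?case unfolding Suc.hyps(2)[symmetric] by (simp add: mult.assoc)
qed

text \<open>Every flattened word starts with 1, so for both kinds of prefix the condition depends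
  only on the second letter \<open>b\<close>. Of the \<open>n - 2\<close> letters other than 1 and
  \<open>b\<close>, exactly \<open>b - 2\<close> exceed 1 and lie below \<open>b\<close>.\<close>

lemma gp_eq_sum_second_letter:
  assumes "n \<ge> 2" and "w = [1] \<or> w = [1, k]"
  shows "gp n w = (\<Sum>b\<in>{2..n}. if prefix w [1, b] then
    (if b = 2 then 2 else 1) * peak_poly True (b - 2) (n - 2) else 0)"
proof -
  have I: "{1..n} = insert 1 {2..n}" using assms(1) by auto
  let ?F = "\<lambda>v. if prefix w v then q ^ peaks v else 0"
  have tail: "(\<Sum>p | p permutes {2..n}. ?F (1 # flatten_from b {2..n} p))
      = (if prefix w [1, b] then peak_poly True (b - 2) (n - 2) else 0)" if b: "b \<in> {2..n}" for b
  proof -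
    have "prefix w (1 # flatten_from b {2..n} p) \<longleftrightarrow> prefix w [1, b]" if p: "p permutes {2..n}" for p
    proof -
      obtain v where "flatten_from b {2..n} p = b # v"
        using flatten_from_eq_Cons[OF p] by blast
      then show ?thesis using assms(2) by auto
    qed
    then have "(\<Sum>p | p permutes {2..n}. ?F (1 # flatten_from b {2..n} p))
        = (if prefix w [1, b] then \<Sum>p | p permutes {2..n}. q ^ peaks (1 # flatten_from b {2..n} p) else 0)"
      by simp
    also have "(\<Sum>p | p permutes {2..n}. q ^ peaks (1 # flatten_from b {2..n} p))
        = peak_poly (1 < b) (card {c \<in> {2..n} - {b}. c < b}) (card ({2..n} - {b}))"
      using sum_peaks_flatten_from[of "{2..n} - {b}" b 1] b by (simp add: insert_absorb)
    also have "{c \<in> {2..n} - {b}. c < b} = {2..<b}" using b by auto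
    also have "card ({2..n} - {b}) = n - 2" using b by simp
    finally show ?thesis using b by simp
  qed
  have "gp n w = (\<Sum>p | p permutes {1..n}. ?F (Flatten n p))"
    unfolding gp_def by (intro sum.mono_neutral_cong_left) (auto simp: finite_permutations)
  also have "\<dots> = (\<Sum>p | p permutes insert 1 {2..n}. ?F (flatten_from 1 (insert 1 {2..n}) p))"
    using Flatten_eq_flatten_from[of _ n] assms(1) unfolding I by (intro sum.cong) auto
  also have "\<dots> = (\<Sum>b\<in>{2..n}. (if b = Min {2..n} then 2 else 1) *
      (\<Sum>p | p permutes {2..n}. ?F (1 # flatten_from b {2..n} p)))"
    using assms(1) by (intro sum_flatten_from) auto
  also have "Min {2..n} = 2" using assms(1) by (intro Min_eqI) auto
  also have "(\<Sum>b\<in>{2..n}. (if b = 2 then 2 else 1) *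
      (\<Sum>p | p permutes {2..n}. ?F (1 # flatten_from b {2..n} p))) = (\<Sum>b\<in>{2..n}. if prefix w [1, b] then
      (if b = 2 then 2 else 1) * peak_poly True (b - 2) (n - 2) else 0)"
    by (intro sum.cong refl) (simp add: tail[simplified])
  finally show ?thesis .
qed

lemma gp_second_letter:
  assumes "2 \<le> k" and "k \<le> n"
  shows "gp n [1, k] = (if k = 2 then 2 else 1) * peak_poly True (k - 2) (n - 2)"
proof -
  have "gp n [1, k] = (\<Sum>b\<in>{2..n}. if k = b then
    (if b = 2 then 2 else 1) * peak_poly True (b - 2) (n - 2) else 0)"
    using gp_eq_sum_second_letter[of n "[1, k]" k] assms by simp
  then show ?thesis using assms by simp
qed

text \<open>Summing over the second letter reproduces one step of the recursion at rank 0. No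
  descent can follow there, so \<open>asc\<close> may be chosen freely.\<close>

lemma gp_eq_peak_poly: "gp (Suc m) [1] = peak_poly asc 0 m"
proof (cases m)
  case 0
  have "Flatten (Suc 0) id = [1]"
    using Flatten_eq_flatten_from[of id "Suc 0"] flatten_from_singleton[of 1]
    by (simp add: permutes_id)
  moreover from this have "{p. p permutes {1..Suc 0} \<and> prefix [1] (Flatten (Suc 0) p)} = {id}"
    by auto
  ultimately show ?thesis unfolding gp_def 0 by (simp add: peaks_short)
next
  case (Suc l)
  have "gp (Suc m) [1] = (\<Sum>b\<in>{0+2..l+2}. (if b = 2 then 2 else 1) * peak_poly True (b - 2) l)"
    using gp_eq_sum_second_letter[of "Suc m" "[1]"] Suc
    by (simp add: numeral_2_eq_2 del: sum.cl_ivl_Suc)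
  also have "\<dots> = (\<Sum>s=0..l. (if s = 0 then 2 else 1) * peak_poly True s l)"
    by (subst sum.shift_bounds_cl_nat_ivl) simp
  finally show ?thesis by (simp add: Suc atMost_atLeast0 lessThan_Suc_atMost del: sum.lessThan_Suc)
qed

section \<open>Neighbouring ranks and the formula for \<open>gp n [1, k]\<close>\<close>

lemma peak_poly_next_rank:
  assumes "r \<le> m"
  shows "peak_poly True (Suc r) (Suc m)
    = peak_poly True r (Suc m) + (if r = 0 then 2 else 1) * (q * peak_poly False r m - peak_poly True r m)"
proof -
  \<comment> \<open>Only the summand \<open>s = r\<close> differs: its letter is reached by an
    ascent from rank \<open>r\<close>, but by a descent from rank \<open>Suc r\<close>, which
    creates a peak.\<close>
  have "peak_poly True (Suc r) (Suc m) - peak_poly True r (Suc m)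
    = (\<Sum>s<Suc m. if s = r then (if r = 0 then 2 else 1) * (q * peak_poly False r m - peak_poly True r m) else 0)"
    unfolding peak_poly.simps sum_subtractf[symmetric]
    by (intro sum.cong refl) (auto simp: algebra_simps not_le less_Suc_eq)
  also have "\<dots> = (if r = 0 then 2 else 1) * (q * peak_poly False r m - peak_poly True r m)"
    using assms by (subst sum.delta) auto
  finally show ?thesis by (simp add: algebra_simps)
qed

text \<open>For \<open>s < r\<close> the next step is a descent; after an ascent it makes a peak,
  whose factor \<open>q\<close> matches the one in front of the first term, so these summands
  cancel. Each \<open>s \<ge> r\<close> leaves \<open>q - 1 = - \<theta>\<close>.\<close>

lemma peak_poly_descent_ascent:
  "q * peak_poly False r (Suc m) - peak_poly True r (Suc m)
    = - \<theta> * (\<Sum>s\<in>{r..m}. (if s = 0 then 2 else 1) * peak_poly True s m)"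
proof -
  have "q * peak_poly False r (Suc m) - peak_poly True r (Suc m)
    = (\<Sum>s<Suc m. if r \<le> s then - \<theta> * ((if s = 0 then 2 else 1) * peak_poly True s m) else 0)"
    unfolding peak_poly.simps sum_subtractf[symmetric] sum_distrib_left
    by (intro sum.cong refl) (auto simp: algebra_simps \<theta>_def)
  also have "\<dots> = (\<Sum>s\<in>{r..m}. - \<theta> * ((if s = 0 then 2 else 1) * peak_poly True s m))"
    by (subst sum.inter_filter[symmetric]) (auto intro!: sum.cong)
  finally show ?thesis by (simp add: sum_distrib_left)
qed

lemma \<beta>_1: "\<beta> k (Suc 0) = 1"
  by (simp add: \<beta>_def binom_def)

lemma \<beta>_eq_0: "r \<ge> 1 \<Longrightarrow> r < j \<Longrightarrow> \<beta> (r + 2) (Suc j) = 0"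
  by (simp add: \<beta>_def binom_def)

text \<open>Pascal's rule in both summands of \<open>\<beta>\<close>. For \<open>r = 0\<close> the
  truncated subtraction \<open>k - 3\<close> would not advance with \<open>k\<close>.\<close>

lemma \<beta>_Pascal:
  assumes "r \<ge> 1"
  shows "\<beta> (r + 3) (j + 2) = \<beta> (r + 2) (j + 2) + \<beta> (r + 2) (j + 1)"
proof (cases j)
  case 0
  then show ?thesis using assms by (simp add: \<beta>_def binom_def)
next
  case (Suc i)
  obtain t where "r = Suc t" using assms by (cases r) auto
  then show ?thesis using Suc
    by (simp add: \<beta>_def binom_def nat_add_distrib nat_diff_distrib' numeral_eq_Suc)
qed

lemma bp_add_2: "bp (i + 2) = \<theta> * bp i"
  by (simp add: bp_def)

lemma sum_1_Suc_eq_sum_atMost: "(\<Sum>j=1..Suc r. f j) = (\<Sum>j\<le>r. f (Suc j))"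
  for f :: "nat \<Rightarrow> 'a :: comm_monoid_add"
  by (intro sum.reindex_bij_witness[of _ Suc "\<lambda>j. j - 1"]) auto

text \<open>The two formulas need each other. Passing from rank \<open>r\<close> to
  \<open>r + 1\<close> subtracts \<theta> times a tail of ranks for words shorter by two; this tail
  is the full sum, a value of \<open>gp\<close>, minus the partial sum of the second formula. The
  partial sum in turn grows by a summand known from the first formula.\<close>

lemma peak_poly_and_partial_sum:
  assumes "r \<ge> 1"
  shows "(r \<le> m \<longrightarrow> peak_poly True r m
      = (\<Sum>j\<le>r. of_nat (\<beta> (r + 2) (j + 1)) * bp (j + 1) * gp (m + 1 - j) [1]))
    \<and> (r \<le> m + 1 \<longrightarrow> (\<Sum>s<r. (if s = 0 then 2 else 1) * peak_poly True s m)
      = (\<Sum>j=1..r. of_nat (\<beta> (r + 2) (j + 1)) * bp j * gp (m + 2 - j) [1]))"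
  using assms
proof (induction r arbitrary: m rule: dec_induct)
  case base
  \<comment> \<open>At rank 0 both flags give \<open>gp m [1]\<close>, and the summand has weight 2,
    so the correction is \<open>2 * (q - 1) * gp m [1]\<close>.\<close>
  have "peak_poly True 1 m = gp (m + 1) [1] - 2 * \<theta> * gp m [1]" if m_pos: "1 \<le> m"
  proof -
    obtain l where m: "m = Suc l" using m_pos by (cases m) auto
    have "peak_poly True 1 m = peak_poly True 0 (Suc l) + 2 * (q * peak_poly False 0 l - peak_poly True 0 l)"
      using peak_poly_next_rank[of 0 l] unfolding m by simp
    then show ?thesis
      by (simp only: m gp_eq_peak_poly[symmetric] Suc_eq_plus1[symmetric]) (simp add: \<theta>_def algebra_simps)
  qed
  moreover have "peak_poly True 0 m = gp (m + 1) [1]"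
    using gp_eq_peak_poly by simp
  ultimately show ?case
    by (auto simp: \<beta>_def binom_def bp_def)
next
  case (step r)
  let ?c = "\<lambda>r j. of_nat (\<beta> (r + 2) (j + 1)) :: rat poly"
  have c: "?c (Suc r) (Suc j) = ?c r (Suc j) + ?c r j" for j
  proof -
    have "Suc r + 2 = r + 3" "Suc j + 1 = j + 2" by simp_all
    then show ?thesis by (simp only: \<beta>_Pascal[OF step.hyps(1)] of_nat_add)
  qed
  have c0: "?c r 0 = 1" for r by (simp add: \<beta>_1)
  \<comment> \<open>The vanishing top coefficient lets sums up to \<open>r\<close> run to
    \<open>Suc r\<close>, so that Pascal's rule applies term by term.\<close>
  have c_top: "?c r (Suc r) = 0" using \<beta>_eq_0[of r "Suc r"] step.hyps by simp
  have "peak_poly True (Suc r) m = (\<Sum>j\<le>Suc r. ?c (Suc r) j * bp (j + 1) * gp (m + 1 - j) [1])"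
    if "Suc r \<le> m"
  proof -
    have "2 \<le> m" using that step.hyps by simp
    then obtain l where m: "m = l + 2" by (metis le_add_diff_inverse2)
    let ?h = "\<lambda>s. (if s = 0 then 2 else 1) * peak_poly True s l"
    have rl: "r \<le> Suc l" using that m by simp
    have split: "{..<Suc l} = {..<r} \<union> {r..l}" using rl by auto
    have "(\<Sum>s<Suc l. ?h s) = (\<Sum>s<r. ?h s) + (\<Sum>s\<in>{r..l}. ?h s)"
      unfolding split by (intro sum.union_disjoint) auto
    moreover have "(\<Sum>s<Suc l. ?h s) = gp m [1]"
      using gp_eq_peak_poly[of "Suc l" True] unfolding m by simp
    ultimately have upper: "(\<Sum>s\<in>{r..l}. ?h s) = gp m [1] - (\<Sum>s<r. ?h s)"
      by (simp only: eq_diff_eq add.commute)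
    have "peak_poly True (Suc r) m = peak_poly True r m - \<theta> * (\<Sum>s\<in>{r..l}. ?h s)"
    proof -
      have "r \<noteq> 0" using step.hyps by simp
      then show ?thesis
        using peak_poly_next_rank[OF rl] unfolding peak_poly_descent_ascent m by simp
    qed
    also have "\<dots> = peak_poly True r m - \<theta> * gp m [1] + \<theta> * (\<Sum>s<r. ?h s)"
      unfolding upper by (simp add: algebra_simps)
    also have "(\<Sum>s<r. ?h s) = (\<Sum>j=1..r. ?c r j * bp j * gp (m - j) [1])"
      using step.IH[of l] rl m by simp
    finally have "peak_poly True (Suc r) m = peak_poly True r m
        + (- \<theta> * gp m [1] + \<theta> * (\<Sum>j=1..r. ?c r j * bp j * gp (m - j) [1]))"
      by simp
    \<comment> \<open>Since \<open>bp 0 = -1\<close>, the isolated term is the summand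
      \<open>j = 0\<close>; the factor \<theta> raises the index of \<open>bp\<close> by
      two.\<close>
    also have "- \<theta> * gp m [1] + \<theta> * (\<Sum>j=1..r. ?c r j * bp j * gp (m - j) [1])
        = (\<Sum>j\<le>r. ?c r j * bp (j + 2) * gp (m - j) [1])"
    proof -
      have "?c r 0 * bp (0 + 2) * gp (m - 0) [1] = - \<theta> * gp m [1]"
        unfolding c0 bp_add_2 by (simp add: bp_def)
      moreover have "(\<Sum>j=1..r. ?c r j * bp (j + 2) * gp (m - j) [1])
          = \<theta> * (\<Sum>j=1..r. ?c r j * bp j * gp (m - j) [1])"
        unfolding bp_add_2 sum_distrib_left by (simp only: mult_ac)
      ultimately show ?thesis
        unfolding atMost_atLeast0 by (subst (2) sum.atLeast_Suc_atMost) simp_all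
    qed
    finally have 1: "peak_poly True (Suc r) m
        = peak_poly True r m + (\<Sum>j\<le>r. ?c r j * bp (j + 2) * gp (m - j) [1])"
      .
    have "peak_poly True r m = (\<Sum>j\<le>Suc r. ?c r j * bp (j + 1) * gp (m + 1 - j) [1])"
      using step.IH[of m] that c_top by simp
    also have "\<dots> = bp 1 * gp (m + 1) [1] + (\<Sum>j\<le>r. ?c r (Suc j) * bp (j + 2) * gp (m - j) [1])"
      unfolding sum.atMost_Suc_shift c0 by simp
    finally have "peak_poly True (Suc r) m
        = bp 1 * gp (m + 1) [1] + (\<Sum>j\<le>r. ?c (Suc r) (Suc j) * bp (j + 2) * gp (m - j) [1])"
      unfolding 1 c distrib_right sum.distrib by (simp only: add.assoc)
    then show ?thesis
      unfolding sum.atMost_Suc_shift c0 by simp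
  qed
  moreover have "(\<Sum>s<Suc r. (if s = 0 then 2 else 1) * peak_poly True s m)
      = (\<Sum>j=1..Suc r. ?c (Suc r) j * bp j * gp (m + 2 - j) [1])" if "Suc r \<le> m + 1"
  proof -
    \<comment> \<open>The new summand \<open>s = r\<close> has weight 1 because
      \<open>r \<ge> 1\<close>.\<close>
    have "(\<Sum>s<Suc r. (if s = 0 then 2 else 1) * peak_poly True s m)
        = (\<Sum>j=1..Suc r. ?c r j * bp j * gp (m + 2 - j) [1]) + peak_poly True r m"
      using step that c_top by simp
    also have "(\<Sum>j=1..Suc r. ?c r j * bp j * gp (m + 2 - j) [1])
        = (\<Sum>j\<le>r. ?c r (Suc j) * bp (j + 1) * gp (m + 1 - j) [1])"
      unfolding sum_1_Suc_eq_sum_atMost by simp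
    also have "peak_poly True r m = (\<Sum>j\<le>r. ?c r j * bp (j + 1) * gp (m + 1 - j) [1])"
      using step.IH[of m] that by simp
    also have "(\<Sum>j\<le>r. ?c r (Suc j) * bp (j + 1) * gp (m + 1 - j) [1]) + \<dots>
        = (\<Sum>j\<le>r. ?c (Suc r) (Suc j) * bp (j + 1) * gp (m + 1 - j) [1])"
      unfolding c distrib_right sum.distrib ..
    also have "\<dots> = (\<Sum>j=1..Suc r. ?c (Suc r) j * bp j * gp (m + 2 - j) [1])"
      unfolding sum_1_Suc_eq_sum_atMost by simp
    finally show ?thesis .
  qed
  ultimately show ?case by blast
qed

text \<open>The rank of \<open>k\<close> is \<open>k - 2 \<ge> 1\<close>, so its weight is 1 and the
  first formula of \<open>peak_poly_and_partial_sum\<close> applies with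
  \<open>i = j + 1\<close>.\<close>

lemma gp_1_k:
  assumes "3 \<le> k" and "k \<le> n"
  shows "gp n [1, k] = (\<Sum>i=1..k-1. of_nat (\<beta> k i) * bp i * gp (n - i) [1])"
proof -
  obtain r where k: "k = r + 3" using assms(1) by (metis le_add_diff_inverse2)
  obtain m where n: "n = m + 2" using assms by (metis le_add_diff_inverse2 add_leD2 k numeral_3_eq_3 numeral_2_eq_2 add_Suc_right Suc_leD le_trans)
  have "gp n [1, k] = peak_poly True (Suc r) m"
    using gp_second_letter[of k n] assms unfolding k n by simp
  also have "\<dots> = (\<Sum>j\<le>Suc r. of_nat (\<beta> k (j + 1)) * bp (j + 1) * gp (m + 1 - j) [1])"
    using peak_poly_and_partial_sum[of "Suc r" m] assms unfolding k n
    by (simp add: numeral_eq_Suc)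
  also have "\<dots> = (\<Sum>i=1..k-1. of_nat (\<beta> k i) * bp i * gp (n - i) [1])"
    unfolding n k using sum_1_Suc_eq_sum_atMost[of "\<lambda>i. of_nat (\<beta> (r + 3) i) * bp i * gp (m + 2 - i) [1]" "Suc r"]
    by (simp add: numeral_3_eq_3)
  finally show ?thesis .
qed

section \<open>Recurrence for \<open>gp n [1]\<close> and the generating functions\<close>

lemma gp_recurrence:
  assumes "N \<ge> 1"
  shows "gp (N + 1) [1]
    = (\<Sum>j=1..N. of_nat ((N choose j) + (N - 1 choose (j - 1))) * bp j * gp (N + 1 - j) [1])"
proof -
  obtain m where N: "N = Suc m" using assms by (cases N) auto
  have "gp (N + 1) [1] = (\<Sum>s<N. (if s = 0 then 2 else 1) * peak_poly True s m)"
    using gp_eq_peak_poly[of N True] N by simp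
  \<comment> \<open>The second formula at its extreme case \<open>r = N = m + 1\<close>, where the
    partial sum exhausts all ranks.\<close>
  also have "\<dots> = (\<Sum>j=1..N. of_nat (\<beta> (N + 2) (j + 1)) * bp j * gp (m + 2 - j) [1])"
    using peak_poly_and_partial_sum[of N m] N by simp
  also have "\<dots> = (\<Sum>j=1..N. of_nat ((N choose j) + (N - 1 choose (j - 1))) * bp j * gp (N + 1 - j) [1])"
    by (intro sum.cong) (auto simp: \<beta>_def binom_def N nat_diff_distrib')
  finally show ?thesis .
qed

text \<open>Multiplying the recurrence by \<open>N / N!\<close> turns its two binomial coefficients
  into \<open>N / (j! (N - j)!)\<close> and \<open>j / (j! (N - j)!)\<close>, whence the factor
  \<open>N + j\<close>.\<close>

lemma Gp_coeff_recurrence: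
  assumes "N \<ge> 1"
  shows "of_nat N * fps_nth Gp N = (\<Sum>j=1..N. of_nat (N + j) * fps_nth Bp j * fps_nth Gp (N - j))"
proof -
  let ?b = "\<lambda>j. to_fract (bp j)" and ?g = "\<lambda>n. to_fract (gp n [1])"
  have of_nat: "to_fract (of_nat k :: rat poly) = of_nat k" for k
    by (induction k) simp_all
  obtain m where N: "N = Suc m" using assms by (cases N) auto
  have binom: "(of_nat N / fact N) * of_nat ((N choose j) + (N - 1 choose (j - 1)))
      = (of_nat (N + j) / (fact j * fact (N - j)) :: rat poly fract)" if j_range: "j \<in> {1..N}" for j
  proof -
    obtain i where j: "j = Suc i" using j_range by (cases j) auto
    have "i \<le> m" using j_range j N by simp
    then have c: "of_nat (N choose j) = (fact N / (fact j * fact (N - j)) :: rat poly fract)"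
      "of_nat (m choose i) = (fact m / (fact i * fact (m - i)) :: rat poly fract)"
      using j_range by (auto intro!: binomial_fact)
    have "of_nat N / fact N * (fact N / (fact j * fact (N - j)))
        = (of_nat N / (fact j * fact (N - j)) :: rat poly fract)"
      by simp
    moreover have "of_nat N / fact N * (fact m / (fact i * fact (m - i)))
        = (of_nat j / (fact j * fact (N - j)) :: rat poly fract)"
      unfolding N j fact_Suc diff_Suc_Suc by (simp del: of_nat_Suc)
    moreover have "N - 1 choose (j - 1) = m choose i" by (simp add: N j)
    ultimately show ?thesis
      by (simp only: of_nat_add c distrib_left add_divide_distrib)
  qed
  have "of_nat N * fps_nth Gp N = (of_nat N / fact N) * ?g (N + 1)"
    by (simp add: Gp_def)
  also have "\<dots> = (\<Sum>j=1..N. (of_nat N / fact N) * of_nat ((N choose j) + (N - 1 choose (j - 1)))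
      * (?b j * ?g (N + 1 - j)))"
    unfolding gp_recurrence[OF assms] to_fract_sum to_fract_mult of_nat sum_distrib_left
    by (simp only: mult.assoc)
  also have "\<dots> = (\<Sum>j=1..N. of_nat (N + j) / (fact j * fact (N - j)) * (?b j * ?g (N + 1 - j)))"
    by (intro sum.cong refl) (simp only: binom)
  also have "\<dots> = (\<Sum>j=1..N. of_nat (N + j) * fps_nth Bp j * fps_nth Gp (N - j))"
    by (intro sum.cong refl) (auto simp: Gp_def Bp_def Suc_diff_le)
  finally show ?thesis .
qed

text \<open>Of the factor \<open>N + j\<close> with \<open>N = m + 1\<close>, the part
  \<open>N\<close> gives the derivative of \<open>Bp * Gp\<close> and the part \<open>j\<close>
  gives \<open>fps_deriv Bp * Gp\<close>. The first convolution may start at \<open>j = 1\<close>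
  because \<open>Bp\<close> has constant coefficient 0.\<close>

lemma fps_deriv_Gp:
  "fps_deriv Gp = fps_deriv (Bp * Gp) + fps_deriv Bp * Gp"
proof (rule fps_ext)
  fix m
  have B0: "fps_nth Bp 0 = 0" by (simp add: Bp_def)
  have "fps_nth (fps_deriv Gp) m = of_nat (Suc m) * fps_nth Gp (Suc m)"
    by simp
  also have "\<dots> = (\<Sum>j=1..Suc m. of_nat (Suc m + j) * fps_nth Bp j * fps_nth Gp (Suc m - j))"
    by (rule Gp_coeff_recurrence) simp
  also have "\<dots> = of_nat (Suc m) * (\<Sum>j=1..Suc m. fps_nth Bp j * fps_nth Gp (Suc m - j))
      + (\<Sum>j=1..Suc m. of_nat j * fps_nth Bp j * fps_nth Gp (Suc m - j))"
    unfolding sum_distrib_left sum.distrib[symmetric]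
    by (intro sum.cong refl) (simp add: algebra_simps)
  also have "(\<Sum>j=1..Suc m. fps_nth Bp j * fps_nth Gp (Suc m - j)) = fps_nth (Bp * Gp) (Suc m)"
    unfolding fps_mult_nth by (subst (2) sum.atLeast_Suc_atMost) (simp_all add: B0)
  also have "(\<Sum>j=1..Suc m. of_nat j * fps_nth Bp j * fps_nth Gp (Suc m - j))
      = fps_nth (fps_deriv Bp * Gp) m"
    unfolding fps_mult_nth One_nat_def sum.shift_bounds_cl_Suc_ivl by simp
  finally show "fps_nth (fps_deriv Gp) m = fps_nth (fps_deriv (Bp * Gp) + fps_deriv Bp * Gp) m"
    by (simp del: fps_deriv_mult)
qed

lemma Gp_closed_form: "Gp = (1 - Bp) powi (-2)"
proof -
  have nz: "fps_nth (1 - Bp) 0 \<noteq> 0" by (simp add: Bp_def)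
  have "fps_deriv Gp * (1 - Bp) = 2 * fps_deriv Bp * Gp"
    using fps_deriv_Gp by (simp add: algebra_simps)
  then have "(fps_deriv Gp * (1 - Bp)) * (1 - Bp) = 2 * fps_deriv Bp * Gp * (1 - Bp)"
    by simp
  \<comment> \<open>The derivative is
    \<open>(1 - Bp) * (fps_deriv Gp * (1 - Bp) - 2 * fps_deriv Bp * Gp)\<close>.\<close>
  then have "fps_deriv (Gp * (1 - Bp) ^ 2) = 0"
    by (simp add: power2_eq_square algebra_simps)
  then have "Gp * (1 - Bp) ^ 2 = fps_const (fps_nth (Gp * (1 - Bp) ^ 2) 0)"
    by (simp only: fps_deriv_eq_0_iff)
  also have "fps_nth (Gp * (1 - Bp) ^ 2) 0 = 1"
    using gp_eq_peak_poly[of 0] by (simp add: Gp_def Bp_def power2_eq_square)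
  finally have "Gp * (1 - Bp) ^ 2 * inverse (1 - Bp) ^ 2 = inverse (1 - Bp) ^ 2"
    by simp
  moreover have "(1 - Bp) ^ 2 * inverse (1 - Bp) ^ 2 = 1"
    unfolding power_mult_distrib[symmetric] inverse_mult_eq_1'[OF nz] by simp
  ultimately have "Gp = inverse (1 - Bp) ^ 2"
    by (simp add: mult.assoc)
  then show ?thesis by (simp add: power_int_def)
qed

text \<open>Coefficients are compared by parity: even ones come from \<open>fps_cosh s\<close>, odd
  ones from \<open>fps_sinh s / fps_const s\<close>. Index 0 is separate, as \<open>Bp\<close> has
  coefficient 0 there although \<open>bp 0 = -1\<close>; the summand 1 makes up for this.\<close>

lemma Bp_closed_form:
  fixes s :: "rat poly fract alg_closure"
  assumes s: "s ^ 2 = to_ac (to_fract \<theta>)"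
  shows "fps_to_ac Bp = 1 + fps_sinh s / fps_const s - fps_cosh s"
proof (rule fps_ext)
  fix n
  \<comment> \<open>A nonzero \<open>s\<close> can be cancelled in the odd coefficients, where
    \<open>s ^ (2 * k + 1) / s\<close> is the image of \<open>\<theta> ^ k\<close>.\<close>
  have "\<theta> \<noteq> 0" by (simp add: \<theta>_def q_def one_pCons)
  then have s0: "s \<noteq> 0" using s by auto
  have theta: "to_ac (to_fract (\<theta> ^ k)) = s ^ (2 * k)" for k
  proof -
    have "to_ac (to_fract (\<theta> ^ k)) = to_ac (to_fract \<theta>) ^ k"
      by (induction k) simp_all
    then show ?thesis by (simp add: power_mult s)
  qed
  have neg: "to_fract ((- 1 :: rat poly) ^ k) = (- 1) ^ k" for k
    by (induction k) simp_all
  have sign: "to_ac ((- 1 :: rat poly fract) ^ k) = (- 1) ^ k" for k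
    by simp
  have fact: "to_ac (fact n :: rat poly fract) = fact n"
    by (metis of_nat_fact to_ac_of_nat)
  consider "n = 0" | k where "n = 2 * k" "k \<ge> 1" | k where "n = 2 * k + 1"
    by (metis One_nat_def Suc_leI evenE gr0I mult_0_right oddE)
  then show "fps_nth (fps_to_ac Bp) n = fps_nth (1 + fps_sinh s / fps_const s - fps_cosh s) n"
  proof cases
    case 1
    then show ?thesis by (simp add: fps_to_ac_def Bp_def fps_sinh_def fps_cosh_def)
  next
    case 2
    then show ?thesis using theta[of k] fact
      by (simp add: fps_to_ac_def Bp_def fps_sinh_def fps_cosh_def bp_def neg sign)
  next
    case 3
    then show ?thesis using theta[of k] fact s0
      by (simp add: fps_to_ac_def Bp_def fps_sinh_def fps_cosh_def bp_def neg sign field_simps del: fact_Suc)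
  qed
qed

theorem theorem3p9:
  shows "(\<forall>n k :: nat. 3 \<le> k \<longrightarrow> k \<le> n \<longrightarrow>
            gp n [1, k] = (\<Sum>i=1..k-1. of_nat (\<beta> k i) * bp i * gp (n - i) [1]))
       \<and> Gp = (1 - Bp) powi (-2)
       \<and> (\<forall>s :: rat poly fract alg_closure. s ^ 2 = to_ac (to_fract \<theta>) \<longrightarrow>
            fps_to_ac Bp = 1 + fps_sinh s / fps_const s - fps_cosh s)"
  using gp_1_k Gp_closed_form Bp_closed_form by blast

end
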